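(* Let $\{P_{u,b}\}_{u\in\mathcal U,\,b\in B_u}$ be a measurement setting family on $\mathcal H=(\mathbb C^2)^{\otimes n}$, let $O=|\psi\rangle\langle\psi|$ with $|\psi\rangle\in\mathcal H$ a unit vector, let $q$ be a probability distribution on $\mathcal U$, and let $g_u(b)\in\mathbb R$ for $u\in\mathcal U$, $b\in B_u$. Put $\alpha_{u,b}=q(u)g_u(b)$, and let $X$ be the output of the one-shot estimator defined by $(q,g)$. Then this estimator is unbiased for $O$, i.e. $\mathbb E_\rho[X]=\operatorname{tr}(\rho O)$ for every density operator $\rho$ on $\mathcal H$, if and only if $$\sum_{u\in\mathcal U}\sum_{b\in B_u}\alpha_{u,b}P_{u,b}=O.$$
   Context: $\mathcal H=(\mathbb C^2)^{\otimes n}$ is the $n$-qubit Hilbert space, of dimension $d=2^n$. A density operator (state) is an operator $\rho\succeq0$ on $\mathcal H$ with $\operatorname{tr}(\rho)=1$. A measurement setting family is a finite collection of operators $P_{u,b}\succeq 0$ on $\mathcal H$, indexed by settings $u\in\mathcal U$ and outcomes $b\in B_u$ (finite sets), such that $\sum_{b\in B_u}P_{u,b}=I$ for each $u\in\mathcal U$. The one-shot estimator defined by $(q,g)$: when the state is $\rho$, sample $u$ from $q$, then obtain outcome $b\in B_u$ with probability $\operatorname{tr}(\rho P_{u,b})$, and output $X=g_u(b)$. $\mathbb E_\rho$ denotes expectation under this procedure. *)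

theory Defs
  imports "HOL-Analysis.Analysis" "HOL-Probability.Probability_Mass_Function"
begin

text \<open>
  The \<open>n\<close>-qubit space is written in the computational basis: \<open>'q\<close> is the finite type of qubits,
  \<open>n = CARD('q)\<close>, and the basis vectors are labelled by the \<open>2 ^ n\<close> bit strings \<open>'q \<Rightarrow> bool\<close>.
\<close>

type_synonym 'q qubit_vec = "complex ^ ('q \<Rightarrow> bool)"
type_synonym 'q qubit_op = "complex ^ ('q \<Rightarrow> bool) ^ ('q \<Rightarrow> bool)"

definition cinner_vec :: "complex ^ 'i \<Rightarrow> complex ^ 'i \<Rightarrow> complex" where
  "cinner_vec v w = (\<Sum>i\<in>UNIV. cnj (v $ i) * w $ i)"

definition ketbra :: "complex ^ 'i \<Rightarrow> complex ^ 'i \<Rightarrow> complex ^ 'i ^ 'i" where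
  "ketbra v w = (\<chi> i j. v $ i * cnj (w $ j))"

text \<open>Over \<open>\<complex>\<close>, requiring the quadratic form to be real and nonnegative forces self-adjointness.\<close>

definition positive_op :: "complex ^ 'i ^ 'i \<Rightarrow> bool" where
  "positive_op A \<longleftrightarrow> (\<forall>v. cinner_vec v (A *v v) \<in> \<real>\<^sub>\<ge>\<^sub>0)"

definition density_op :: "complex ^ 'i ^ 'i \<Rightarrow> bool" where
  "density_op \<rho> \<longleftrightarrow> positive_op \<rho> \<and> trace \<rho> = 1"

definition measurement_setting_family ::
  "'u set \<Rightarrow> ('u \<Rightarrow> 'b set) \<Rightarrow> ('u \<Rightarrow> 'b \<Rightarrow> complex ^ 'i ^ 'i) \<Rightarrow> bool" where
  "measurement_setting_family U B P \<longleftrightarrow>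
     finite U \<and>
     (\<forall>u\<in>U. finite (B u) \<and> (\<forall>b\<in>B u. positive_op (P u b)) \<and> (\<Sum>b\<in>B u. P u b) = mat 1)"

text \<open>
  For a density operator \<open>\<rho>\<close> and positive operators \<open>M b\<close> summing to the identity, every
  \<open>trace (\<rho> ** M b)\<close> is real and nonnegative and these numbers add up to 1, so the function passed
  to \<^const>\<open>embed_pmf\<close> is a probability mass function and \<^const>\<open>Re\<close> loses nothing.
\<close>

definition outcome_pmf ::
  "complex ^ 'i ^ 'i \<Rightarrow> 'b set \<Rightarrow> ('b \<Rightarrow> complex ^ 'i ^ 'i) \<Rightarrow> 'b pmf" where
  "outcome_pmf \<rho> S M = embed_pmf (\<lambda>b. if b \<in> S then Re (trace (\<rho> ** M b)) else 0)"

definition one_shot_estimator ::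
  "('u \<Rightarrow> 'b set) \<Rightarrow> ('u \<Rightarrow> 'b \<Rightarrow> complex ^ 'i ^ 'i) \<Rightarrow> 'u pmf \<Rightarrow> ('u \<Rightarrow> 'b \<Rightarrow> real) \<Rightarrow>
     complex ^ 'i ^ 'i \<Rightarrow> real pmf" where
  "one_shot_estimator B P q g \<rho> =
     bind_pmf q (\<lambda>u. bind_pmf (outcome_pmf \<rho> (B u) (P u)) (\<lambda>b. return_pmf (g u b)))"

definition unbiased_for ::
  "('u \<Rightarrow> 'b set) \<Rightarrow> ('u \<Rightarrow> 'b \<Rightarrow> complex ^ 'i ^ 'i) \<Rightarrow> 'u pmf \<Rightarrow> ('u \<Rightarrow> 'b \<Rightarrow> real) \<Rightarrow>
     complex ^ 'i ^ 'i \<Rightarrow> bool" where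
  "unbiased_for B P q g A \<longleftrightarrow>
     (\<forall>\<rho>. density_op \<rho> \<longrightarrow>
        complex_of_real (measure_pmf.expectation (one_shot_estimator B P q g \<rho>) (\<lambda>x. x)) =
          trace (\<rho> ** A))"

end

theory Submission
  imports Defs
begin

text \<open>
  Averaging out both sampling steps gives \<open>E\<^sub>\<rho>[X] = tr (\<rho> M)\<close> with \<open>M = \<Sum> \<alpha> P\<close>. Unbiasedness thus
  says that \<open>D = M - obs\<close> satisfies \<open>tr (\<rho> D) = 0\<close> for all states; on pure states this makes the
  quadratic form of \<open>D\<close> vanish, which over \<open>\<complex>\<close> forces \<open>D = 0\<close>. That the Born weights are
  nonnegative follows by peeling rank-one terms off a positive operator with Schur complements
  (a Cholesky decomposition), so that no spectral theorem is needed.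
\<close>

subsection \<open>Quadratic forms\<close>

lemma cinner_vec_add_left: "cinner_vec (u + v) w = cinner_vec u w + cinner_vec v w"
  by (simp add: cinner_vec_def algebra_simps sum.distrib)

lemma cinner_vec_add_right: "cinner_vec u (v + w) = cinner_vec u v + cinner_vec u w"
  by (simp add: cinner_vec_def algebra_simps sum.distrib)

lemma cinner_vec_diff_right: "cinner_vec u (v - w) = cinner_vec u v - cinner_vec u w"
  by (simp add: cinner_vec_def algebra_simps sum_subtractf)

lemma cinner_vec_scale_left: "cinner_vec (c *s v) w = cnj c * cinner_vec v w"
  by (simp add: cinner_vec_def sum_distrib_left mult_ac)

lemma cinner_vec_scale_right: "cinner_vec v (c *s w) = c * cinner_vec v w"
  by (simp add: cinner_vec_def sum_distrib_left mult_ac)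

lemma cinner_vec_commute: "cinner_vec v w = cnj (cinner_vec w v)"
  by (simp add: cinner_vec_def mult_ac)

lemma cinner_vec_axis_left: "cinner_vec (axis i 1) w = w $ i"
proof -
  have "cinner_vec (axis i 1) w = (\<Sum>k\<in>UNIV. if k = i then w $ k else 0)"
    unfolding cinner_vec_def by (rule sum.cong) (auto simp: axis_def)
  then show ?thesis by simp
qed

lemma cinner_vec_self: "cinner_vec v v = of_real ((norm v)\<^sup>2)"
proof -
  have "(norm v)\<^sup>2 = (\<Sum>i\<in>UNIV. (norm (v $ i))\<^sup>2)"
    by (simp add: norm_vec_def L2_set_def sum_nonneg)
  then show ?thesis
    by (simp add: cinner_vec_def complex_norm_square mult_ac del: of_real_power)
qed

lemma matrix_vector_mult_axis_nth:
  fixes A :: "complex ^ 'n ^ 'm"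
  shows "(A *v axis j 1) $ i = A $ i $ j"
proof -
  have "(A *v axis j 1) $ i = (\<Sum>k\<in>UNIV. if k = j then A $ i $ k else 0)"
    unfolding matrix_vector_mult_def vec_lambda_beta by (rule sum.cong) (auto simp: axis_def)
  then show ?thesis by simp
qed

lemma ketbra_mult_vec: "ketbra u w *v v = cinner_vec w v *s u"
  by (simp add: vec_eq_iff ketbra_def matrix_vector_mult_def cinner_vec_def sum_distrib_left mult_ac)

lemma trace_mult_ketbra: "trace (\<rho> ** ketbra u w) = cinner_vec w (\<rho> *v u)"
  unfolding trace_def matrix_matrix_mult_def ketbra_def cinner_vec_def matrix_vector_mult_def
  by (simp add: sum_distrib_left sum_distrib_right mult_ac)

text \<open>Taking \<open>c\<close> among the fourth roots of unity separates the real and imaginary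
  parts of the off-diagonal entries, as in polarization.\<close>

lemma quadratic_form_two_axes:
  fixes A :: "complex ^ 'i ^ 'i"
  shows "cinner_vec (axis i 1 + c *s axis j 1) (A *v (axis i 1 + c *s axis j 1)) =
    A $ i $ i + c * A $ i $ j + cnj c * A $ j $ i + cnj c * c * A $ j $ j"
  by (simp add: matrix_vector_right_distrib vector_scalar_commute cinner_vec_add_left
      cinner_vec_add_right cinner_vec_scale_left cinner_vec_scale_right cinner_vec_axis_left
      matrix_vector_mult_axis_nth algebra_simps)

subsection \<open>Positive operators\<close>

lemma positive_op_ketbra: "positive_op (ketbra v v)"
proof -
  have "cinner_vec w (ketbra v v *v w) = of_real ((cmod (cinner_vec v w))\<^sup>2)" for w
    by (subst complex_norm_square, subst cinner_vec_commute[of v w])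
      (simp add: ketbra_mult_vec cinner_vec_scale_right cinner_vec_commute[of v w] mult_ac)
  then show ?thesis by (simp add: positive_op_def nonneg_Reals_of_real_iff)
qed

lemma positive_op_diag:
  assumes "positive_op A"
  shows "A $ i $ i \<in> \<real>\<^sub>\<ge>\<^sub>0"
  using assms[unfolded positive_op_def, rule_format, of "axis i 1"]
  by (simp add: cinner_vec_axis_left matrix_vector_mult_axis_nth)

lemma positive_op_two_axes:
  assumes "positive_op A"
  shows "A $ i $ i + c * A $ i $ j + cnj c * A $ j $ i + cnj c * c * A $ j $ j \<in> \<real>\<^sub>\<ge>\<^sub>0"
  using assms unfolding positive_op_def quadratic_form_two_axes[symmetric] by blast

text \<open>Since the form is real, \<open>c = 1\<close> makes the imaginary parts of the two
  entries cancel, and \<open>c\<close> the imaginary unit makes their real parts agree.\<close>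

lemma positive_op_hermitian:
  assumes "positive_op A"
  shows "cnj (A $ i $ j) = A $ j $ i"
  using positive_op_two_axes[OF assms, of i 1 j] positive_op_two_axes[OF assms, of i \<i> j]
    positive_op_diag[OF assms, of i] positive_op_diag[OF assms, of j]
  by (auto simp: complex_nonneg_Reals_iff complex_eq_iff)

text \<open>With zero diagonal the form at two axes is real-linear in \<open>c\<close>. Being
  nonnegative at both \<open>c\<close> and \<open>-c\<close>, it vanishes; \<open>c = 1\<close> and
  the imaginary unit then give the sum and the difference of the two entries as 0.\<close>

lemma positive_op_eq_0:
  assumes "positive_op A" and "\<And>i. A $ i $ i = 0"
  shows "A = 0"
proof -
  have "A $ i $ j = 0" for i j
    using positive_op_two_axes[OF assms(1), of i 1 j] positive_op_two_axes[OF assms(1), of i "-1" j]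
      positive_op_two_axes[OF assms(1), of i \<i> j] positive_op_two_axes[OF assms(1), of i "-\<i>" j]
    by (auto simp: assms(2) complex_nonneg_Reals_iff complex_eq_iff)
  then show ?thesis by (simp add: vec_eq_iff)
qed

text \<open>A vanishing form is in particular nonnegative, so \<open>A\<close> counts as positive
  and has zero diagonal.\<close>

lemma quadratic_form_eq_0:
  assumes "\<And>v. cinner_vec v (A *v v) = 0"
  shows "A = 0"
proof (rule positive_op_eq_0)
  show "positive_op A" by (simp add: positive_op_def assms)
  show "A $ i $ i = 0" for i
    using assms[of "axis i 1"] by (simp add: cinner_vec_axis_left matrix_vector_mult_axis_nth)
qed

text \<open>Here \<open>u\<close> is a Cholesky column: column \<open>i\<close> of \<open>A\<close>
  over the root of its pivot. Positivity survives because the form of the difference at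
  \<open>v\<close> is the form of \<open>A\<close> at a shifted vector.\<close>

lemma positive_op_schur_complement:
  fixes A :: "complex ^ 'i ^ 'i"
  assumes pos: "positive_op A" and nz: "A $ i $ i \<noteq> 0"
  defines "u \<equiv> of_real (1 / sqrt (Re (A $ i $ i))) *s (A *v axis i 1)"
  shows "positive_op (A - ketbra u u)" and "(A - ketbra u u) $ i $ i = 0"
proof -
  define a where "a = Re (A $ i $ i)"
  have Aii: "A $ i $ i = of_real a" and a: "a > 0"
    using positive_op_diag[OF pos, of i] nz
    by (auto simp: a_def complex_nonneg_Reals_iff complex_eq_iff)
  have uu: "u = of_real (1 / sqrt a) *s (A *v axis i 1)"
    by (simp add: u_def a_def)
  have sq: "complex_of_real (sqrt a) * complex_of_real (sqrt a) = of_real a"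
    using a by (simp flip: of_real_mult)
  have a0: "complex_of_real a \<noteq> 0" using a by simp
  show "(A - ketbra u u) $ i $ i = 0"
    using a0 by (simp add: uu ketbra_def matrix_vector_mult_axis_nth Aii sq)
  \<comment> \<open>Self-adjointness turns the pairing with column \<open>i\<close> into a
    coordinate of \<open>A *v v\<close>.\<close>
  have w: "cinner_vec v (A *v axis i 1) = cnj ((A *v v) $ i)" for v
    unfolding cinner_vec_def matrix_vector_mult_axis_nth
    by (simp add: matrix_vector_mult_def positive_op_hermitian[OF pos] mult_ac)
  show "positive_op (A - ketbra u u)"
    unfolding positive_op_def
  proof
    fix v
    define z where "z = (A *v v) $ i"
    \<comment> \<open>\<open>v + c *s axis i 1\<close> minimises the form along its line.\<close>
    define c where "c = - z / of_real a"
    let ?v' = "v + c *s axis i 1"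
    have "cinner_vec ?v' (A *v ?v') =
        cinner_vec v (A *v v) + c * cnj z + cnj c * z + cnj c * c * of_real a"
      by (simp add: matrix_vector_right_distrib vector_scalar_commute cinner_vec_add_left
        cinner_vec_add_right cinner_vec_scale_left cinner_vec_scale_right cinner_vec_axis_left
        matrix_vector_mult_axis_nth w Aii z_def algebra_simps)
    \<comment> \<open>For this \<open>c\<close> the three correction terms are -t, -t and t, where t
      is the squared modulus of \<open>z\<close> over \<open>a\<close>.\<close>
    then have "cinner_vec ?v' (A *v ?v') = cinner_vec v (A *v v) - cnj z * z / of_real a"
      using a0 by (simp add: c_def mult_ac)
    moreover have "cinner_vec v u = of_real (1 / sqrt a) * cnj z"
      unfolding uu cinner_vec_scale_right w z_def ..
    then have "cinner_vec v (ketbra u u *v v) = cnj z * z / of_real a"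
      unfolding ketbra_mult_vec cinner_vec_scale_right cinner_vec_commute[of u v]
      using a0 by (simp add: sq mult_ac)
    ultimately have "cinner_vec v ((A - ketbra u u) *v v) = cinner_vec ?v' (A *v ?v')"
      by (simp add: matrix_vector_mult_diff_rdistrib cinner_vec_diff_right)
    then show "cinner_vec v ((A - ketbra u u) *v v) \<in> \<real>\<^sub>\<ge>\<^sub>0"
      using pos unfolding positive_op_def by metis
  qed
qed

text \<open>Each Schur step removes a term \<open>ketbra u u\<close>, whose trace against
  \<open>\<rho>\<close> is the form of \<open>\<rho>\<close> at \<open>u\<close>, and lowers the
  number of nonzero diagonal entries. With none left, \<open>A\<close> is 0.\<close>

lemma trace_mult_positive_nonneg:
  fixes \<rho> A :: "complex ^ 'i ^ 'i"
  assumes rho: "positive_op \<rho>" and "positive_op A"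
  shows "trace (\<rho> ** A) \<in> \<real>\<^sub>\<ge>\<^sub>0"
  using assms(2)
proof (induction "card {i. A $ i $ i \<noteq> 0}" arbitrary: A rule: less_induct)
  case less
  show ?case
  proof (cases "\<forall>i. A $ i $ i = 0")
    case True
    then have "A = 0" using positive_op_eq_0 less.prems by blast
    then show ?thesis by (simp add: trace_def matrix_matrix_mult_def)
  next
    case False
    then obtain i where i: "A $ i $ i \<noteq> 0" by blast
    obtain u where pos: "positive_op (A - ketbra u u)" and zero: "(A - ketbra u u) $ i $ i = 0"
      using positive_op_schur_complement[OF less.prems i] by blast
    \<comment> \<open>No diagonal zero is lost: the new entry is minus a squared modulus, yet
      nonnegative by positivity.\<close>
    have "(A - ketbra u u) $ j $ j = 0" if "A $ j $ j = 0" for j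
    proof -
      have "u $ j * cnj (u $ j) = of_real ((cmod (u $ j))\<^sup>2)"
        by (simp only: complex_norm_square)
      then show ?thesis
        using positive_op_diag[OF pos, of j] that
        by (auto simp: ketbra_def complex_nonneg_Reals_iff simp flip: of_real_power)
    qed
    then have "{j. (A - ketbra u u) $ j $ j \<noteq> 0} \<subset> {j. A $ j $ j \<noteq> 0}"
      using zero i by blast
    then have "card {j. (A - ketbra u u) $ j $ j \<noteq> 0} < card {j. A $ j $ j \<noteq> 0}"
      by (intro psubset_card_mono) auto
    then have "trace (\<rho> ** (A - ketbra u u)) \<in> \<real>\<^sub>\<ge>\<^sub>0"
      using less.hyps pos by blast
    moreover have "trace (\<rho> ** ketbra u u) \<in> \<real>\<^sub>\<ge>\<^sub>0"
      using rho by (simp add: trace_mult_ketbra positive_op_def)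
    ultimately have "trace (\<rho> ** (A - ketbra u u)) + trace (\<rho> ** ketbra u u) \<in> \<real>\<^sub>\<ge>\<^sub>0"
      by (rule nonneg_Reals_add_I)
    moreover have "\<rho> ** A = \<rho> ** (A - ketbra u u) + \<rho> ** ketbra u u"
      by (simp flip: matrix_add_ldistrib)
    ultimately show ?thesis by (simp add: trace_add)
  qed
qed

section \<open>The trace pairing and separation of operators by states\<close>

lemma trace_mult_sum_right:
  fixes \<rho> :: "complex ^ 'i ^ 'i"
  shows "trace (\<rho> ** (\<Sum>x\<in>S. M x)) = (\<Sum>x\<in>S. trace (\<rho> ** M x))"
proof (induction S rule: infinite_finite_induct)
  case (insert x S)
  then show ?case by (simp add: matrix_add_ldistrib trace_add)
qed (simp_all add: trace_def matrix_matrix_mult_def)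

lemma trace_mult_scaleR_right:
  fixes \<rho> M :: "complex ^ 'i ^ 'i"
  shows "trace (\<rho> ** (c *\<^sub>R M)) = of_real c * trace (\<rho> ** M)"
  by (simp add: trace_def matrix_matrix_mult_def sum_distrib_left
      scaleR_conv_of_real[where 'a = complex] mult_ac)

lemma density_op_ketbra:
  assumes "norm v = 1"
  shows "density_op (ketbra v v)"
proof -
  have "trace (ketbra v v) = cinner_vec v v"
    by (simp add: trace_def ketbra_def cinner_vec_def mult_ac)
  then show ?thesis using assms by (simp add: density_op_def positive_op_ketbra cinner_vec_self)
qed

text \<open>Pure states suffice: they evaluate the form of \<open>A\<close> at unit vectors, and
  homogeneity extends this to all vectors.\<close>

lemma trace_mult_density_op_eq_0:
  assumes "\<And>\<rho>. density_op \<rho> \<Longrightarrow> trace (\<rho> ** A) = 0"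
  shows "A = 0"
proof (rule quadratic_form_eq_0)
  fix v
  show "cinner_vec v (A *v v) = 0"
  proof (cases "v = 0")
    case True
    then show ?thesis by (simp add: cinner_vec_def)
  next
    case False
    define w where "w = complex_of_real (1 / norm v) *s v"
    \<comment> \<open>The real scaling serves to compute the norm, the complex one to pull the
      factor out of the form.\<close>
    have w: "w = (1 / norm v) *\<^sub>R v"
      by (simp add: w_def vec_eq_iff scaleR_conv_of_real[where 'a = complex])
    have "norm w = 1" using False by (simp add: w)
    then have "trace (ketbra w w ** A) = 0" using assms density_op_ketbra by blast
    then have "cinner_vec w (A *v w) = 0"
      by (subst (asm) trace_mul_sym) (simp add: trace_mult_ketbra)
    then show ?thesis
      using False by (simp add: w_def vector_scalar_commute cinner_vec_scale_left cinner_vec_scale_right)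
  qed
qed

subsection \<open>The one-shot estimator\<close>

lemma trace_mult_Re:
  assumes "positive_op \<rho>" and "positive_op A"
  shows "of_real (Re (trace (\<rho> ** A))) = trace (\<rho> ** A)"
  using trace_mult_positive_nonneg[OF assms] by (simp add: complex_nonneg_Reals_iff complex_eq_iff)

text \<open>\<open>embed_pmf\<close> returns its weights only if they are nonnegative and have total
  mass 1. The mass is the trace of \<open>\<rho>\<close> times the identity.\<close>

lemma pmf_outcome_pmf:
  fixes \<rho> :: "complex ^ 'i ^ 'i"
  assumes rho: "density_op \<rho>" and fin: "finite S"
    and pos: "\<And>b. b \<in> S \<Longrightarrow> positive_op (M b)" and total: "(\<Sum>b\<in>S. M b) = mat 1"
  shows "pmf (outcome_pmf \<rho> S M) b = (if b \<in> S then Re (trace (\<rho> ** M b)) else 0)"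
  unfolding outcome_pmf_def
proof (rule pmf_embed_pmf)
  let ?p = "\<lambda>b. if b \<in> S then Re (trace (\<rho> ** M b)) else 0"
  show nonneg: "0 \<le> ?p b" for b
    using trace_mult_positive_nonneg[of \<rho> "M b"] rho pos
    by (auto simp: density_op_def complex_nonneg_Reals_iff)
  have "(\<Sum>b\<in>S. Re (trace (\<rho> ** M b))) = Re (trace (\<rho> ** (\<Sum>b\<in>S. M b)))"
    by (simp add: trace_mult_sum_right)
  then have one: "(\<Sum>b\<in>S. ?p b) = 1"
    using rho by (simp add: total density_op_def)
  have "(\<integral>\<^sup>+ b. ennreal (?p b) \<partial>count_space UNIV) = (\<Sum>b\<in>S. ennreal (?p b))"
    using fin by (intro nn_integral_count_space') auto
  also have "\<dots> = ennreal (\<Sum>b\<in>S. ?p b)"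
    by (intro sum_ennreal nonneg)
  finally show "(\<integral>\<^sup>+ b. ennreal (?p b) \<partial>count_space UNIV) = 1"
    unfolding one by simp
qed

lemma expectation_one_shot_estimator:
  fixes P :: "'u \<Rightarrow> 'b \<Rightarrow> complex ^ 'i ^ 'i"
  assumes fam: "measurement_setting_family U B P" and q: "set_pmf q \<subseteq> U" and rho: "density_op \<rho>"
  shows "complex_of_real (measure_pmf.expectation (one_shot_estimator B P q g \<rho>) (\<lambda>x. x)) =
    trace (\<rho> ** (\<Sum>u\<in>U. \<Sum>b\<in>B u. (pmf q u * g u b) *\<^sub>R P u b))"
proof -
  have fU: "finite U" and fB: "\<And>u. u \<in> U \<Longrightarrow> finite (B u)"
    and posP: "\<And>u b. u \<in> U \<Longrightarrow> b \<in> B u \<Longrightarrow> positive_op (P u b)"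
    and total: "\<And>u. u \<in> U \<Longrightarrow> (\<Sum>b\<in>B u. P u b) = mat 1"
    using fam by (auto simp: measurement_setting_family_def)
  have pos: "positive_op \<rho>" using rho by (simp add: density_op_def)
  let ?o = "\<lambda>u. outcome_pmf \<rho> (B u) (P u)"
  have pmf_o: "pmf (?o u) b = (if b \<in> B u then Re (trace (\<rho> ** P u b)) else 0)" if "u \<in> U" for u b
    using that by (intro pmf_outcome_pmf rho fB posP total) auto
  \<comment> \<open>Finite support lets the expectation of a bind be expanded as a finite
    sum.\<close>
  have sub: "set_pmf (?o u) \<subseteq> B u" if "u \<in> U" for u
    using pmf_o[OF that] by (auto simp: set_pmf_iff split: if_splits)
  let ?X = "\<lambda>u. bind_pmf (?o u) (\<lambda>b. return_pmf (g u b))"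
  have inner: "measure_pmf.expectation (?X u) (\<lambda>x. x) =
      (\<Sum>b\<in>B u. Re (trace (\<rho> ** P u b)) * g u b)" if "u \<in> U" for u
    by (subst pmf_expectation_bind[OF fB[OF that] _ sub[OF that]]) (simp_all add: pmf_o that)
  have "measure_pmf.expectation (one_shot_estimator B P q g \<rho>) (\<lambda>x. x) =
      (\<Sum>u\<in>U. pmf q u * measure_pmf.expectation (?X u) (\<lambda>x. x))"
    unfolding one_shot_estimator_def
    by (subst pmf_expectation_bind[OF fU _ q])
      (auto intro: finite_subset[OF sub fB])
  also have "\<dots> = (\<Sum>u\<in>U. pmf q u * (\<Sum>b\<in>B u. Re (trace (\<rho> ** P u b)) * g u b))"
    by (simp add: inner)
  finally show ?thesis
    by (simp add: trace_mult_sum_right trace_mult_scaleR_right trace_mult_Re[OF pos posP]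
        sum_distrib_left mult_ac)
qed

theorem mainTheorem1:
  fixes U :: "'u set" and B :: "'u \<Rightarrow> 'b set"
    and P :: "'u \<Rightarrow> 'b \<Rightarrow> ('q::finite) qubit_op"
    and \<psi> :: "'q qubit_vec" and obs :: "'q qubit_op"
    and q :: "'u pmf" and g \<alpha> :: "'u \<Rightarrow> 'b \<Rightarrow> real"
  assumes "measurement_setting_family U B P"
    and "norm \<psi> = 1"
    and "obs = ketbra \<psi> \<psi>"
    and "set_pmf q \<subseteq> U"
    and "\<And>u b. u \<in> U \<Longrightarrow> b \<in> B u \<Longrightarrow> \<alpha> u b = pmf q u * g u b"
  shows "unbiased_for B P q g obs \<longleftrightarrow> (\<Sum>u\<in>U. \<Sum>b\<in>B u. \<alpha> u b *\<^sub>R P u b) = obs"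
proof -
  define M where "M = (\<Sum>u\<in>U. \<Sum>b\<in>B u. \<alpha> u b *\<^sub>R P u b)"
  \<comment> \<open>\<open>\<alpha>\<close> is prescribed on the index set only, so it is rewritten
    under the sums.\<close>
  have M: "M = (\<Sum>u\<in>U. \<Sum>b\<in>B u. (pmf q u * g u b) *\<^sub>R P u b)"
    unfolding M_def by (intro sum.cong refl) (simp add: assms(5))
  have unbiased: "unbiased_for B P q g obs \<longleftrightarrow>
      (\<forall>\<rho>. density_op \<rho> \<longrightarrow> trace (\<rho> ** M) = trace (\<rho> ** obs))"
    unfolding unbiased_for_def M
    by (simp add: expectation_one_shot_estimator[OF assms(1,4)])
  \<comment> \<open>Only this direction needs an argument: states separate operators. The converse
    is substitution.\<close>
  have "M = obs" if eq: "\<forall>\<rho>. density_op \<rho> \<longrightarrow> trace (\<rho> ** M) = trace (\<rho> ** obs)"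
  proof -
    have "trace (\<rho> ** (M - obs)) = 0" if "density_op \<rho>" for \<rho>
    proof -
      have "trace (\<rho> ** M) = trace (\<rho> ** (M - obs)) + trace (\<rho> ** obs)"
        by (simp flip: matrix_add_ldistrib trace_add)
      then show ?thesis using eq that by simp
    qed
    then show ?thesis using trace_mult_density_op_eq_0 by fastforce
  qed
  then show ?thesis
    unfolding unbiased M_def[symmetric] by blast
qed

end
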